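(* Let $\lambda\ge0$, $f(\alpha)=e^{-\lambda\alpha}$, and let $n\ge1$ be an integer. Let $H$ be any sampling algorithm for exponential decay, producing at each time $t_k$ a random sample $S^H_k\subseteq\mathcal{U}_k=\bigcup_{i=1}^k\mathcal{B}_i$, that satisfies $$\Pr[x\in S^H_k]/\Pr[y\in S^H_k]=f(\alpha_{i,k})/f(\alpha_{j,k})$$ for all $i\le j\le k$, $x\in\mathcal{B}_i$ and $y\in\mathcal{B}_j$. Let $S_k$ be the sample produced at time $t_k$ by the R-TBS algorithm for exponential decay with decay rate $\lambda$ and maximum sample size $n$. If the total weight $W_k=\sum_{i=1}^k|\mathcal{B}_i|f(\alpha_{i,k})$ at some time $t_k$ with $k\ge1$ satisfies $W_k<n$, then $\mathbb{E}[|S^H_k|]\le\mathbb{E}[|S_k|]$.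
   Context: Setting. $\mathcal{B}_1,\mathcal{B}_2,\ldots$ is a given sequence of pairwise disjoint finite sets of items (possibly empty); batch $\mathcal{B}_k$ arrives at time $t_k=k\Delta$, $\Delta>0$ fixed, and $t_0=0$. For $i\le k$, $\alpha_{i,k}=t_k-t_i$ is the age at time $t_k$ of items of $\mathcal{B}_i$. Write $\operatorname{frac}(x)=x-\lfloor x\rfloor$. Convention: $n/0=\infty$. Latent samples. A latent sample of a set $U$ with sample weight $C\ge0$ is a triple $L=(A,\pi,C)$ with $A\subseteq U$ a set of $\lfloor C\rfloor$ "full" items and $\pi\subseteq U$ (disjoint from $A$) a set with at most one "partial" item, nonempty iff $C>\lfloor C\rfloor$. GETSAMPLE$(A,\pi,C)$: draw $U$ uniform on $[0,1]$; return $A\cup\pi$ if $U\le\operatorname{frac}(C)$, else return $A$. Below, SAMPLE$(A,m)$ is a uniform random subset of $A$ of size $\min(m,|A|)$. SWAP1$(A,\pi)$: draw $I=$ SAMPLE$(A,1)$ and return $((A\setminus I)\cup\pi,\ I)$. MOVE1$(A,\pi)$: draw $I=$ SAMPLE$(A,1)$ and return $(A\setminus I,\ I)$. DOWNSAMPLE$((A,\pi,C),\theta)$ for $\theta\in(0,1)$: set $C'=\theta C$, draw $U$ uniform on $[0,1]$, start with $(A',\pi')=(A,\pi)$. - If $\lfloor C'\rfloor=0$: if $U>\operatorname{frac}(C)/C$ set $(A',\pi')=$ SWAP1$(A,\pi)$; then set $A'=\emptyset$. - Else if $\lfloor C'\rfloor=\lfloor C\rfloor$: if $U>(1-\theta\operatorname{frac}(C))/(1-\operatorname{frac}(C'))$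 set $(A',\pi')=$ SWAP1$(A,\pi)$. - Else ($0<\lfloor C'\rfloor<\lfloor C\rfloor$): if $U\le\theta\operatorname{frac}(C)$ set $A'=$ SAMPLE$(A,\lfloor C'\rfloor)$ and then $(A',\pi')=$ SWAP1$(A',\pi)$; otherwise set $A'=$ SAMPLE$(A,\lfloor C'\rfloor+1)$ and then $(A',\pi')=$ MOVE1$(A',\pi)$. Finally, if $C'$ is an integer set $\pi'=\emptyset$. Return $(A',\pi',C')$. For $\theta=1$ the input is returned unchanged, and the empty latent sample $(\emptyset,\emptyset,0)$ is always returned unchanged. UNION$((A_1,\pi_1,C_1),(A_2,\pi_2,C_2))$ for disjoint latent samples: set $C=C_1+C_2$, $a=\operatorname{frac}(C_1)$, $b=\operatorname{frac}(C_2)$, draw $U$ uniform on $[0,1]$. - If $a+b<1$: $A=A_1\cup A_2$; $\pi=\pi_1$ if $U\le a/(a+b)$, else $\pi=\pi_2$ (if $a=b=0$, $\pi=\emptyset$). - If $a+b=1$: $\pi=\emptyset$; $A=A_1\cup A_2\cup\pi_1$ if $U\le a$, else $A=A_1\cup A_2\cup\pi_2$. - If $a+b>1$: if $U\le(1-a)/[(1-a)+(1-b)]$ then $\pi=\pi_1$, $A=A_1\cup A_2\cup\pi_2$; else $\pi=\pi_2$, $A=A_1\cup A_2\cup\pi_1$. Return $(A,\pi,C)$. R-TBS for exponential decay (decay rate $\lambda\ge0$, maximum sample size $n$). Initialize $W=0$, latent sample $L=(\emptyset,\emptyset,0)$, $\rho=1$. For $k=1,2,\ldots$: set $\theta=e^{-\lambda(t_k-t_{k-1})}$;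 $W\leftarrow\theta W+|\mathcal{B}_k|$; $\rho'\leftarrow\rho$; $\rho\leftarrow\min(1,n/W)$; if the weight of $L$ is positive, $L\leftarrow$ DOWNSAMPLE$(L,(\rho/\rho')\theta)$; $L_0\leftarrow$ DOWNSAMPLE$((\mathcal{B}_k,\emptyset,|\mathcal{B}_k|),\rho)$; $L\leftarrow$ UNION$(L_0,L)$; denote this latent sample by $L_k=(A_k,\pi_k,C_k)$; output $S_k=$ GETSAMPLE$(L_k)$. All random draws are mutually independent.
   Formalization: Added: if λ>0 and some item has arrived by t_k, then B_k is nonempty. Otherwise the claim fails: for λ>0, n=2, B_1={x}, other batches empty, H always returning {x} obeys the ratio law but has mean size 1 > e^{-λΔ} = E|S_2|. *)

theory Defs
  imports "HOL-Probability.Probability"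
begin

definition arrival :: "real \<Rightarrow> nat \<Rightarrow> real" where
  "arrival \<Delta> k = real k * \<Delta>"

definition age :: "real \<Rightarrow> nat \<Rightarrow> nat \<Rightarrow> real" where
  "age \<Delta> i k = arrival \<Delta> k - arrival \<Delta> i"

definition decay :: "real \<Rightarrow> real \<Rightarrow> real" where
  "decay lam \<alpha> = exp (- lam * \<alpha>)"

text \<open>Every uniform variate \<open>U\<close> drawn by the algorithms below is used in exactly one comparison
  \<open>U \<le> p\<close>.  \<open>uniform_le p\<close> is the law of the outcome of a fresh such comparison; the lemma after
  it states this as an image measure.\<close>

definition uniform_le :: "real \<Rightarrow> bool pmf" where
  "uniform_le p = bernoulli_pmf (measure (uniform_measure lborel {0..1}) {u. u \<le> p})"

lemma measure_pmf_uniform_le: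
  "measure_pmf (uniform_le p) =
     distr (uniform_measure lborel {0..1::real}) (count_space UNIV) (\<lambda>u. u \<le> p)"
proof -
  let ?U = "uniform_measure lborel {0..1::real}"
  interpret prob_space ?U
    by (rule prob_space_uniform_measure) auto
  have meas: "(\<lambda>u. u \<le> p) \<in> ?U \<rightarrow>\<^sub>M count_space UNIV"
    by measurable
  interpret D: prob_space "distr ?U (count_space UNIV) (\<lambda>u. u \<le> p)"
    by (rule prob_space_distr[OF meas])
  have neg: "prob {u. \<not> u \<le> p} = 1 - prob {u. u \<le> p}"
    using prob_neg[of "\<lambda>u. u \<le> p"] by simp
  define q where "q = prob {u. u \<le> p}"
  have q: "0 \<le> q" "q \<le> 1"
    unfolding q_def by (rule measure_nonneg, rule prob_le_1)
  have space: "space ?U = UNIV"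
    by simp
  have pre: "(\<lambda>u. u \<le> p) -` {True} \<inter> space ?U = {u. u \<le> p}"
      "(\<lambda>u. u \<le> p) -` {False} \<inter> space ?U = {u. \<not> u \<le> p}"
    unfolding space by auto
  show ?thesis
  proof (rule measure_eqI_countable[of _ UNIV])
    fix b :: bool
    have "measure (distr ?U (count_space UNIV) (\<lambda>u. u \<le> p)) {b} = pmf (bernoulli_pmf q) b"
      using q neg by (cases b) (simp_all only: measure_distr[OF meas] sets_count_space Pow_UNIV
        UNIV_I pre pmf_bernoulli_True pmf_bernoulli_False q_def[symmetric])
    then show "emeasure (measure_pmf (uniform_le p)) {b} =
        emeasure (distr ?U (count_space UNIV) (\<lambda>u. u \<le> p)) {b}"
      by (simp only: D.emeasure_eq_measure emeasure_pmf_single uniform_le_def q_def)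
  qed auto
qed

text \<open>Triples \<open>(A, \<pi>, C)\<close> of full items, partial items and sample weight.\<close>

type_synonym 'a latent = "'a set \<times> 'a set \<times> real"

fun get_sample :: "'a latent \<Rightarrow> 'a set pmf" where
  "get_sample (A, \<pi>, C) = do {
     le \<leftarrow> uniform_le (frac C);
     return_pmf (if le then A \<union> \<pi> else A)
   }"

definition sample :: "'a set \<Rightarrow> nat \<Rightarrow> 'a set pmf" where
  "sample A m = pmf_of_set {S. S \<subseteq> A \<and> card S = min m (card A)}"

definition swap1 :: "'a set \<Rightarrow> 'a set \<Rightarrow> ('a set \<times> 'a set) pmf" where
  "swap1 A \<pi> = do { I \<leftarrow> sample A 1; return_pmf ((A - I) \<union> \<pi>, I) }"

definition move1 :: "'a set \<Rightarrow> 'a set \<Rightarrow> ('a set \<times> 'a set) pmf" where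
  "move1 A \<pi> = do { I \<leftarrow> sample A 1; return_pmf (A - I, I) }"

fun downsample :: "'a latent \<Rightarrow> real \<Rightarrow> 'a latent pmf" where
  "downsample (A, \<pi>, C) \<theta> =
     (if \<theta> = 1 \<or> (A, \<pi>, C) = ({}, {}, 0) then return_pmf (A, \<pi>, C)
      else let C' = \<theta> * C in do {
        (A', \<pi>') \<leftarrow>
          (if \<lfloor>C'\<rfloor> = 0 then do {
             le \<leftarrow> uniform_le (frac C / C);
             (A', \<pi>') \<leftarrow> (if le then return_pmf (A, \<pi>) else swap1 A \<pi>);
             return_pmf ({}, \<pi>')
           }
           else if \<lfloor>C'\<rfloor> = \<lfloor>C\<rfloor> then do {
             le \<leftarrow> uniform_le ((1 - \<theta> * frac C) / (1 - frac C'));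
             (if le then return_pmf (A, \<pi>) else swap1 A \<pi>)
           }
           else do {
             le \<leftarrow> uniform_le (\<theta> * frac C);
             (if le then do { A' \<leftarrow> sample A (nat \<lfloor>C'\<rfloor>); swap1 A' \<pi> }
              else do { A' \<leftarrow> sample A (nat \<lfloor>C'\<rfloor> + 1); move1 A' \<pi> })
           });
        return_pmf (A', if C' \<in> \<int> then {} else \<pi>', C')
      })"

fun latent_union :: "'a latent \<Rightarrow> 'a latent \<Rightarrow> 'a latent pmf" where
  "latent_union (A\<^sub>1, \<pi>\<^sub>1, C\<^sub>1) (A\<^sub>2, \<pi>\<^sub>2, C\<^sub>2) =
     (let C = C\<^sub>1 + C\<^sub>2; a = frac C\<^sub>1; b = frac C\<^sub>2 in
      if a = 0 \<and> b = 0 then return_pmf (A\<^sub>1 \<union> A\<^sub>2, {}, C)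
      else if a + b < 1 then do {
        le \<leftarrow> uniform_le (a / (a + b));
        return_pmf (A\<^sub>1 \<union> A\<^sub>2, if le then \<pi>\<^sub>1 else \<pi>\<^sub>2, C)
      }
      else if a + b = 1 then do {
        le \<leftarrow> uniform_le a;
        return_pmf (A\<^sub>1 \<union> A\<^sub>2 \<union> (if le then \<pi>\<^sub>1 else \<pi>\<^sub>2), {}, C)
      }
      else do {
        le \<leftarrow> uniform_le ((1 - a) / ((1 - a) + (1 - b)));
        return_pmf (if le then (A\<^sub>1 \<union> A\<^sub>2 \<union> \<pi>\<^sub>2, \<pi>\<^sub>1, C) else (A\<^sub>1 \<union> A\<^sub>2 \<union> \<pi>\<^sub>1, \<pi>\<^sub>2, C))
      })"

text \<open>The parameters of R-TBS are the decay rate \<open>lam\<close>, the spacing \<open>\<Delta>\<close> of arrival times, the maximum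
  sample size \<open>n\<close> and the batches \<open>B 1, B 2, \<dots>\<close>; \<open>B 0\<close> is never used.  The variables \<open>W\<close> and \<open>\<rho>\<close>
  of the algorithm evolve deterministically, so only the latent sample is carried as a random state.\<close>

primrec rtbs_weight :: "real \<Rightarrow> real \<Rightarrow> (nat \<Rightarrow> 'a set) \<Rightarrow> nat \<Rightarrow> real" where
  "rtbs_weight lam \<Delta> B 0 = 0"
| "rtbs_weight lam \<Delta> B (Suc k) =
     exp (- lam * (arrival \<Delta> (Suc k) - arrival \<Delta> k)) * rtbs_weight lam \<Delta> B k + real (card (B (Suc k)))"

text \<open>The case distinction implements the convention \<open>n / 0 = \<infinity>\<close>.\<close>

primrec rtbs_rho :: "real \<Rightarrow> real \<Rightarrow> nat \<Rightarrow> (nat \<Rightarrow> 'a set) \<Rightarrow> nat \<Rightarrow> real" where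
  "rtbs_rho lam \<Delta> n B 0 = 1"
| "rtbs_rho lam \<Delta> n B (Suc k) =
     (let W = rtbs_weight lam \<Delta> B (Suc k) in if W = 0 then 1 else min 1 (real n / W))"

text \<open>Monadic composition of kernels makes all random draws mutually independent.\<close>

primrec rtbs_latent :: "real \<Rightarrow> real \<Rightarrow> nat \<Rightarrow> (nat \<Rightarrow> 'a set) \<Rightarrow> nat \<Rightarrow> 'a latent pmf" where
  "rtbs_latent lam \<Delta> n B 0 = return_pmf ({}, {}, 0)"
| "rtbs_latent lam \<Delta> n B (Suc k) =
     (let \<theta> = exp (- lam * (arrival \<Delta> (Suc k) - arrival \<Delta> k));
          \<rho>' = rtbs_rho lam \<Delta> n B k;
          \<rho> = rtbs_rho lam \<Delta> n B (Suc k)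
      in do {
        (A, \<pi>, C) \<leftarrow> rtbs_latent lam \<Delta> n B k;
        L \<leftarrow> (if C > 0 then downsample (A, \<pi>, C) ((\<rho> / \<rho>') * \<theta>) else return_pmf (A, \<pi>, C));
        L\<^sub>0 \<leftarrow> downsample (B (Suc k), {}, real (card (B (Suc k)))) \<rho>;
        latent_union L\<^sub>0 L
      })"

definition rtbs_sample :: "real \<Rightarrow> real \<Rightarrow> nat \<Rightarrow> (nat \<Rightarrow> 'a set) \<Rightarrow> nat \<Rightarrow> 'a set pmf" where
  "rtbs_sample lam \<Delta> n B k = do { L \<leftarrow> rtbs_latent lam \<Delta> n B k; get_sample L }"

text \<open>The comparison of a sampling scheme with R-TBS at time \<open>arrival \<Delta> k\<close> needs \<open>B k \<noteq> {}\<close> unless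
  \<open>lam = 0\<close> or no item has arrived at all.  For \<open>lam > 0\<close>, \<open>n = 2\<close>, \<open>B 1 = {x}\<close>, all other batches
  empty, the constant sample \<open>{x}\<close> satisfies the ratio law, but has size \<open>1\<close>, whereas the expected
  R-TBS sample size at time \<open>arrival \<Delta> 2\<close> is \<open>exp (- lam * \<Delta>) < 1\<close>.\<close>

end

theory Submission
  imports Defs
begin

text \<open>Every latent sample that R-TBS can reach at time \<open>k\<close> is well formed and has the deterministic
  weight \<open>\<rho>\<^sub>k W\<^sub>k\<close>. Its realised sample has mean size \<open>\<lfloor>C\<rfloor> + frac C = C\<close>, which is \<open>W\<^sub>k\<close> as soon as
  \<open>W\<^sub>k < n\<close>. For the competing scheme, comparing \<open>x \<in> B\<^sub>i\<close> with an item of the current batch, whose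
  age is \<open>0\<close>, bounds the inclusion probability of \<open>x\<close> by \<open>f(\<alpha>\<^sub>i\<^sub>,\<^sub>k)\<close>; summing over all items gives
  \<open>W\<^sub>k\<close> again.\<close>

section \<open>Supports of uniform comparisons and of random subsets\<close>

lemma uniform_le_eq_bernoulli:
  assumes "0 \<le> p" "p \<le> 1"
  shows "uniform_le p = bernoulli_pmf p"
proof -
  have "{0..1} \<inter> {u. u \<le> p} = {0..p}"
    using assms by auto
  moreover have "{u. u \<le> p} \<in> sets lborel"
    by measurable
  ultimately have "measure (uniform_measure lborel {0..1}) {u. u \<le> p} = p"
    using assms by (simp add: measure_uniform_measure)
  then show ?thesis
    by (simp add: uniform_le_def)
qed

text \<open>A branch taken with probability 0 is absent from the support. This lemma and the next
  one exclude the branches of the algorithms that would promote or keep a partial item that does not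
  exist, or draw from an empty set of full items.\<close>

lemma True_in_uniform_le:
  assumes "0 \<le> p" "p \<le> 1" "True \<in> set_pmf (uniform_le p)"
  shows "0 < p"
  using assms by (simp add: uniform_le_eq_bernoulli set_pmf_iff)

lemma False_in_uniform_le:
  assumes "0 \<le> p" "p \<le> 1" "False \<in> set_pmf (uniform_le p)"
  shows "p < 1"
  using assms by (simp add: uniform_le_eq_bernoulli set_pmf_iff)

lemma set_pmf_sample:
  assumes "finite A"
  shows "set_pmf (sample A m) = {S. S \<subseteq> A \<and> card S = min m (card A)}"
proof -
  \<comment> \<open>The witness shows that the set under \<open>pmf_of_set\<close> is nonempty; for
    an empty set the support would not be determined.\<close>
  obtain S where "S \<subseteq> A" "card S = min m (card A)"
    using obtain_subset_with_card_n[of "min m (card A)" A] by auto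
  then show ?thesis
    using assms unfolding sample_def by (intro set_pmf_of_set) auto
qed

section \<open>Well-formed latent samples and their preservation by the operations\<close>

text \<open>The weight is a parameter shared by all members, so a support contained in this set has
  a deterministic weight as well as the right cardinalities. The condition
  \<open>C \<notin> \<int>\<close> stands for \<open>C > \<lfloor>C\<rfloor>\<close>.\<close>

definition latent_samples :: "'a set \<Rightarrow> real \<Rightarrow> 'a latent set" where
  "latent_samples U C =
     {(A, \<pi>, C) |A \<pi>. A \<subseteq> U \<and> \<pi> \<subseteq> U \<and> A \<inter> \<pi> = {} \<and> card A = nat \<lfloor>C\<rfloor> \<and> card \<pi> = of_bool (C \<notin> \<int>)}"

lemma latent_samples_iff:
  "(A, \<pi>, D) \<in> latent_samples U C \<longleftrightarrow>
     D = C \<and> A \<subseteq> U \<and> \<pi> \<subseteq> U \<and> A \<inter> \<pi> = {} \<and> card A = nat \<lfloor>C\<rfloor> \<and> card \<pi> = of_bool (C \<notin> \<int>)"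
  unfolding latent_samples_def by auto

text \<open>For nonempty \<open>A\<close> the size \<open>min 1 (card A)\<close> of the draw is 1,
  so exactly one full item is removed and becomes the partial item.\<close>

lemma swap1_support:
  assumes "(A', \<pi>') \<in> set_pmf (swap1 A \<pi>)" "finite A" "A \<noteq> {}"
  obtains x where "x \<in> A" "A' = A - {x} \<union> \<pi>" "\<pi>' = {x}"
proof -
  have "min 1 (card A) = 1"
    using assms by (simp add: Suc_le_eq card_gt_0_iff)
  then show ?thesis
    using assms that by (auto simp: swap1_def set_pmf_sample card_1_singleton_iff)
qed

lemma move1_support:
  assumes "(A', \<pi>') \<in> set_pmf (move1 A \<pi>)" "finite A" "A \<noteq> {}"
  obtains x where "x \<in> A" "A' = A - {x}" "\<pi>' = {x}"
proof -
  have "min 1 (card A) = 1"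
    using assms by (simp add: Suc_le_eq card_gt_0_iff)
  then show ?thesis
    using assms that by (auto simp: move1_def set_pmf_sample card_1_singleton_iff)
qed

text \<open>Each branch leaves \<open>\<lfloor>\<theta> * C\<rfloor>\<close> full items. The
  branches that rely on an existing partial item have positive probability only if \<open>C\<close>
  is not an integer, so the required item is there.\<close>

lemma downsample_support:
  assumes U: "finite U" and C: "0 \<le> C" and L: "L \<in> latent_samples U C"
    and \<theta>: "0 < \<theta>" "\<theta> \<le> 1"
  shows "set_pmf (downsample L \<theta>) \<subseteq> latent_samples U (\<theta> * C)"
proof -
  obtain A \<pi> where L_eq: "L = (A, \<pi>, C)"
    using L by (auto simp: latent_samples_def)
  have wf: "A \<subseteq> U" "\<pi> \<subseteq> U" "A \<inter> \<pi> = {}" "card A = nat \<lfloor>C\<rfloor>" "card \<pi> = of_bool (C \<notin> \<int>)"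
    using L by (auto simp: L_eq latent_samples_iff)
  have fin: "finite A" "finite \<pi>"
    using wf U by (auto intro: finite_subset)
  show ?thesis
  proof (cases "\<theta> = 1 \<or> L = ({}, {}, 0)")
    case True
    then show ?thesis
      using L by (auto simp: L_eq latent_samples_iff)
  next
    case False
    \<comment> \<open>For \<open>C = 0\<close> well-formedness leaves only the empty latent sample,
      which the case distinction has excluded.\<close>
    have "C > 0"
    proof (rule ccontr)
      assume "\<not> C > 0"
      with C have "C = 0" by simp
      with wf fin False show False by (simp add: L_eq)
    qed
    define C' where "C' = \<theta> * C"
    have C': "0 < C'" "C' < C"
      using False \<theta> \<open>C > 0\<close> by (auto simp: C'_def L_eq)
    have floor_le: "\<lfloor>C'\<rfloor> \<le> \<lfloor>C\<rfloor>" "0 \<le> \<lfloor>C'\<rfloor>" "0 \<le> \<lfloor>C\<rfloor>"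
      using C' by (auto intro: floor_mono)
    \<comment> \<open>This is the invariant before the final clean-up. The cardinality of
      \<open>\<pi>'\<close> is constrained only for non-integral \<open>C'\<close>, because
      otherwise the clean-up empties \<open>\<pi>'\<close>.\<close>
    define wf' where "wf' A' \<pi>' \<longleftrightarrow> A' \<subseteq> U \<and> \<pi>' \<subseteq> U \<and> A' \<inter> \<pi>' = {} \<and>
      card A' = nat \<lfloor>C'\<rfloor> \<and> (C' \<notin> \<int> \<longrightarrow> card \<pi>' = 1)" for A' \<pi>' :: "'a set"
    define X where "X =
      (if \<lfloor>C'\<rfloor> = 0 then do {
         le \<leftarrow> uniform_le (frac C / C);
         (A', \<pi>') \<leftarrow> (if le then return_pmf (A, \<pi>) else swap1 A \<pi>);
         return_pmf ({}, \<pi>')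
       }
       else if \<lfloor>C'\<rfloor> = \<lfloor>C\<rfloor> then do {
         le \<leftarrow> uniform_le ((1 - \<theta> * frac C) / (1 - frac C'));
         (if le then return_pmf (A, \<pi>) else swap1 A \<pi>)
       }
       else do {
         le \<leftarrow> uniform_le (\<theta> * frac C);
         (if le then do { A' \<leftarrow> sample A (nat \<lfloor>C'\<rfloor>); swap1 A' \<pi> }
          else do { A' \<leftarrow> sample A (nat \<lfloor>C'\<rfloor> + 1); move1 A' \<pi> })
       })"
    have downsample_eq: "downsample L \<theta> =
        X \<bind> (\<lambda>(A', \<pi>'). return_pmf (A', if C' \<in> \<int> then {} else \<pi>', C'))"
      unfolding L_eq downsample.simps if_not_P[OF False[unfolded L_eq]] Let_def C'_def[symmetric] X_def ..
    \<comment> \<open>Shared by the cases \<open>same\<close> and \<open>less\<close>: one full item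
      leaves and the single partial item enters, so the number of full items stays
      \<open>\<lfloor>C'\<rfloor>\<close>.\<close>
    have swap: "wf' A'' \<pi>''"
      if "(A'', \<pi>'') \<in> set_pmf (swap1 A' \<pi>)" "A' \<subseteq> A" "card A' = nat \<lfloor>C'\<rfloor>" "\<lfloor>C'\<rfloor> \<noteq> 0" "C \<notin> \<int>"
      for A' A'' \<pi>''
    proof -
      have "finite A'"
        using that fin by (auto intro: finite_subset)
      have "\<lfloor>C'\<rfloor> > 0"
        using that floor_le by linarith
      then have "A' \<noteq> {}"
        using that(3) by auto
      obtain x where x: "x \<in> A'" "A'' = A' - {x} \<union> \<pi>" "\<pi>'' = {x}"
        by (rule swap1_support[OF \<open>(A'', \<pi>'') \<in> set_pmf (swap1 A' \<pi>)\<close> \<open>finite A'\<close> \<open>A' \<noteq> {}\<close>])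
      have "card A'' = card (A' - {x}) + card \<pi>"
        unfolding x(2) using wf that \<open>finite A'\<close> fin by (intro card_Un_disjoint) auto
      also have "card \<pi> = 1"
        using wf that by simp
      also have "card (A' - {x}) + 1 = card A'"
        using card_Suc_Diff1[OF \<open>finite A'\<close> x(1)] by (simp only: Suc_eq_plus1)
      finally show ?thesis
        using x wf that by (auto simp: wf'_def)
    qed
    consider (zero) "\<lfloor>C'\<rfloor> = 0" | (same) "\<lfloor>C'\<rfloor> \<noteq> 0" "\<lfloor>C'\<rfloor> = \<lfloor>C\<rfloor>" | (less) "\<lfloor>C'\<rfloor> \<noteq> 0" "\<lfloor>C'\<rfloor> \<noteq> \<lfloor>C\<rfloor>"
      by blast
    then have "wf' A' \<pi>'" if X: "(A', \<pi>') \<in> set_pmf X" for A' \<pi>'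
    proof cases
      case zero
      have p: "0 \<le> frac C / C" "frac C / C \<le> 1"
        using \<open>C > 0\<close> floor_le by (auto simp: frac_def)
      \<comment> \<open>Keeping \<open>\<pi>\<close> has positive probability only if
        \<open>frac C > 0\<close>, when a partial item exists. Swapping has positive probability
        only if \<open>frac C < C\<close>, when a full item exists that can become partial.\<close>
      have le: "wf' {} \<pi>" if "True \<in> set_pmf (uniform_le (frac C / C))"
      proof -
        have "C \<notin> \<int>"
          using True_in_uniform_le[OF p that] \<open>C > 0\<close> by (simp add: zero_less_divide_iff)
        then show ?thesis
          using wf zero by (simp add: wf'_def)
      qed
      have gr: "wf' {} \<pi>'"
        if "False \<in> set_pmf (uniform_le (frac C / C))" "(A', \<pi>') \<in> set_pmf (swap1 A \<pi>)" for A' \<pi>'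
      proof -
        have "\<lfloor>C\<rfloor> > 0"
          using False_in_uniform_le[OF p that(1)] \<open>C > 0\<close> by (simp add: frac_def)
        then have "A \<noteq> {}"
          using wf by auto
        then show ?thesis
          using that(2) fin wf zero by (auto simp: wf'_def elim!: swap1_support)
      qed
      obtain le A'' where "le \<in> set_pmf (uniform_le (frac C / C))" "A' = {}"
        "(A'', \<pi>') \<in> set_pmf (if le then return_pmf (A, \<pi>) else swap1 A \<pi>)"
        using X zero by (force simp: X_def)
      then show ?thesis
        using le gr by (cases le) auto
    next
      case same
      \<comment> \<open>Below an integer \<open>C\<close> the floor would already have dropped,
        contrary to \<open>\<lfloor>C'\<rfloor> = \<lfloor>C\<rfloor>\<close>.\<close>
      have "C \<notin> \<int>"
      proof
        assume "C \<in> \<int>"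
        then have "C' < of_int \<lfloor>C\<rfloor>"
          using C' by (auto elim!: Ints_cases)
        then show False
          using same by linarith
      qed
      have "wf' A \<pi>"
        using wf same \<open>C \<notin> \<int>\<close> by (simp add: wf'_def)
      moreover have "wf' A' \<pi>'" if "(A', \<pi>') \<in> set_pmf (swap1 A \<pi>)" for A' \<pi>'
        using swap[OF that] wf same \<open>C \<notin> \<int>\<close> by simp
      ultimately show ?thesis
        using that same by (auto simp: X_def split: if_splits)
    next
      case less
      have p: "0 \<le> \<theta> * frac C" "\<theta> * frac C \<le> 1"
        using \<theta> frac_ge_0[of C] frac_lt_1[of C] by (auto intro!: mult_le_one)
      have le: "wf' A'' \<pi>''"
        if "True \<in> set_pmf (uniform_le (\<theta> * frac C))" "A' \<in> set_pmf (sample A (nat \<lfloor>C'\<rfloor>))"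
          "(A'', \<pi>'') \<in> set_pmf (swap1 A' \<pi>)" for A' A'' \<pi>''
      proof -
        have "C \<notin> \<int>"
          using True_in_uniform_le[OF p that(1)] \<theta> by (simp add: zero_less_mult_iff)
        then show ?thesis
          using swap[OF that(3)] that(2) fin wf less floor_le by (auto simp: set_pmf_sample min_def)
      qed
      have gr: "wf' A'' \<pi>''"
        if "A' \<in> set_pmf (sample A (nat \<lfloor>C'\<rfloor> + 1))" "(A'', \<pi>'') \<in> set_pmf (move1 A' \<pi>)" for A' A'' \<pi>''
      proof -
        \<comment> \<open>Strict descent of the floor ensures that \<open>sample\<close> really
          returns \<open>\<lfloor>C'\<rfloor> + 1\<close> items instead of being capped by
          \<open>card A\<close>; \<open>move1\<close> then gives up the extra one.\<close>
        have Suc_le: "nat \<lfloor>C'\<rfloor> + 1 \<le> nat \<lfloor>C\<rfloor>"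
          using less floor_le by linarith
        have A': "A' \<subseteq> A" "card A' = nat \<lfloor>C'\<rfloor> + 1"
          using that(1) fin wf(4) Suc_le by (auto simp: set_pmf_sample min_def)
        then have "finite A'" "A' \<noteq> {}"
          using fin by (auto intro: finite_subset)
        then obtain x where "x \<in> A'" "A'' = A' - {x}" "\<pi>'' = {x}"
          by (rule move1_support[OF \<open>(A'', \<pi>'') \<in> set_pmf (move1 A' \<pi>)\<close>])
        then show ?thesis
          using A' wf \<open>finite A'\<close> by (auto simp: wf'_def)
      qed
      show ?thesis
        using that less le gr by (auto simp: X_def split: if_splits)
    qed
    then show ?thesis
      unfolding downsample_eq C'_def[symmetric] by (fastforce simp: latent_samples_iff wf'_def)
  qed
qed

text \<open>The floor of the total weight is \<open>\<lfloor>C\<^sub>1\<rfloor> +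
  \<lfloor>C\<^sub>2\<rfloor> + \<lfloor>a + b\<rfloor>\<close> with \<open>a\<close>,
  \<open>b\<close> the fractional parts. Hence a partial item must be promoted to full exactly when
  \<open>a + b\<close> reaches 1, and one remains partial exactly when \<open>a + b\<close> is not
  an integer.\<close>

lemma latent_union_support:
  assumes L: "L\<^sub>1 \<in> latent_samples U\<^sub>1 C\<^sub>1" "L\<^sub>2 \<in> latent_samples U\<^sub>2 C\<^sub>2"
    and C: "0 \<le> C\<^sub>1" "0 \<le> C\<^sub>2" and U: "finite U\<^sub>1" "finite U\<^sub>2" "U\<^sub>1 \<inter> U\<^sub>2 = {}"
  shows "set_pmf (latent_union L\<^sub>1 L\<^sub>2) \<subseteq> latent_samples (U\<^sub>1 \<union> U\<^sub>2) (C\<^sub>1 + C\<^sub>2)"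
proof -
  obtain A\<^sub>1 \<pi>\<^sub>1 A\<^sub>2 \<pi>\<^sub>2 where L_eq: "L\<^sub>1 = (A\<^sub>1, \<pi>\<^sub>1, C\<^sub>1)" "L\<^sub>2 = (A\<^sub>2, \<pi>\<^sub>2, C\<^sub>2)"
    using L by (auto simp: latent_samples_def)
  define a b where "a = frac C\<^sub>1" and "b = frac C\<^sub>2"
  have ab: "0 \<le> a" "a < 1" "0 \<le> b" "b < 1"
    by (auto simp: a_def b_def frac_lt_1)
  have wf: "A\<^sub>1 \<subseteq> U\<^sub>1" "\<pi>\<^sub>1 \<subseteq> U\<^sub>1" "A\<^sub>1 \<inter> \<pi>\<^sub>1 = {}" "card A\<^sub>1 = nat \<lfloor>C\<^sub>1\<rfloor>" "card \<pi>\<^sub>1 = of_bool (a \<noteq> 0)"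
    "A\<^sub>2 \<subseteq> U\<^sub>2" "\<pi>\<^sub>2 \<subseteq> U\<^sub>2" "A\<^sub>2 \<inter> \<pi>\<^sub>2 = {}" "card A\<^sub>2 = nat \<lfloor>C\<^sub>2\<rfloor>" "card \<pi>\<^sub>2 = of_bool (b \<noteq> 0)"
    using L by (auto simp: L_eq latent_samples_iff a_def b_def)
  have fin: "finite A\<^sub>1" "finite \<pi>\<^sub>1" "finite A\<^sub>2" "finite \<pi>\<^sub>2"
    using wf U by (auto intro: finite_subset)
  have disj: "A\<^sub>1 \<inter> A\<^sub>2 = {}" "A\<^sub>1 \<inter> \<pi>\<^sub>2 = {}" "\<pi>\<^sub>1 \<inter> A\<^sub>2 = {}" "\<pi>\<^sub>1 \<inter> \<pi>\<^sub>2 = {}"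
    using wf U by auto
  have card_A: "card (A\<^sub>1 \<union> A\<^sub>2) = nat (\<lfloor>C\<^sub>1\<rfloor> + \<lfloor>C\<^sub>2\<rfloor>)"
    using wf fin disj C by (simp add: card_Un_disjoint nat_add_distrib)
  \<comment> \<open>Promotion of one partial item, which exists because its fractional part is
    nonzero.\<close>
  have card_A\<pi>: "card (A\<^sub>1 \<union> A\<^sub>2 \<union> \<pi>) = nat (\<lfloor>C\<^sub>1\<rfloor> + \<lfloor>C\<^sub>2\<rfloor> + 1)"
    if "\<pi> = \<pi>\<^sub>1 \<and> a \<noteq> 0 \<or> \<pi> = \<pi>\<^sub>2 \<and> b \<noteq> 0" for \<pi>
  proof -
    have "card (A\<^sub>1 \<union> A\<^sub>2 \<union> \<pi>) = card (A\<^sub>1 \<union> A\<^sub>2) + card \<pi>"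
      using that fin disj wf by (intro card_Un_disjoint) auto
    also have "card \<pi> = 1"
      using that wf by auto
    finally show ?thesis
      using C card_A by (simp add: nat_add_distrib)
  qed
  have C_eq: "C\<^sub>1 + C\<^sub>2 = of_int (\<lfloor>C\<^sub>1\<rfloor> + \<lfloor>C\<^sub>2\<rfloor>) + (a + b)"
    by (simp add: a_def b_def frac_def)
  have int_iff: "C\<^sub>1 + C\<^sub>2 \<in> \<int> \<longleftrightarrow> a + b \<in> \<int>"
  proof
    assume "C\<^sub>1 + C\<^sub>2 \<in> \<int>"
    then have "C\<^sub>1 + C\<^sub>2 - of_int (\<lfloor>C\<^sub>1\<rfloor> + \<lfloor>C\<^sub>2\<rfloor>) \<in> \<int>"
      by (intro Ints_diff Ints_of_int)
    moreover have "C\<^sub>1 + C\<^sub>2 - of_int (\<lfloor>C\<^sub>1\<rfloor> + \<lfloor>C\<^sub>2\<rfloor>) = a + b"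
      using C_eq by linarith
    ultimately show "a + b \<in> \<int>"
      by (simp only:)
  next
    assume "a + b \<in> \<int>"
    then show "C\<^sub>1 + C\<^sub>2 \<in> \<int>"
      using Ints_add[OF Ints_of_int[of "\<lfloor>C\<^sub>1\<rfloor> + \<lfloor>C\<^sub>2\<rfloor>"]] C_eq by (simp only:)
  qed
  have floor_eq: "\<lfloor>C\<^sub>1 + C\<^sub>2\<rfloor> = \<lfloor>C\<^sub>1\<rfloor> + \<lfloor>C\<^sub>2\<rfloor> + \<lfloor>a + b\<rfloor>"
    by (subst C_eq) (simp del: of_int_add)
  have sub: "A\<^sub>1 \<union> A\<^sub>2 \<subseteq> U\<^sub>1 \<union> U\<^sub>2" "\<pi>\<^sub>1 \<subseteq> U\<^sub>1 \<union> U\<^sub>2" "\<pi>\<^sub>2 \<subseteq> U\<^sub>1 \<union> U\<^sub>2"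
    using wf by auto
  have disj': "(A\<^sub>1 \<union> A\<^sub>2) \<inter> \<pi>\<^sub>1 = {}" "(A\<^sub>1 \<union> A\<^sub>2) \<inter> \<pi>\<^sub>2 = {}"
    using wf(3,8) disj by auto
  consider (zero) "a = 0" "b = 0" | (less) "\<not> (a = 0 \<and> b = 0)" "a + b < 1"
    | (eq) "\<not> (a = 0 \<and> b = 0)" "a + b = 1" | (gr) "\<not> (a = 0 \<and> b = 0)" "\<not> a + b < 1" "a + b \<noteq> 1"
    by blast
  then show ?thesis
  proof cases
    case zero
    then show ?thesis
      using sub card_A floor_eq int_iff
      by (simp add: L_eq Let_def latent_samples_iff a_def[symmetric] b_def[symmetric])
  next
    case less
    then have "0 < a + b"
      using ab by linarith
    then have int: "a + b \<notin> \<int>" "\<lfloor>a + b\<rfloor> = 0"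
      using less by (auto elim!: Ints_cases simp: floor_eq_iff)
    have new: "(A\<^sub>1 \<union> A\<^sub>2, \<pi>, C\<^sub>1 + C\<^sub>2) \<in> latent_samples (U\<^sub>1 \<union> U\<^sub>2) (C\<^sub>1 + C\<^sub>2)"
      if "\<pi> = \<pi>\<^sub>1 \<and> a \<noteq> 0 \<or> \<pi> = \<pi>\<^sub>2 \<and> b \<noteq> 0" for \<pi>
      unfolding latent_samples_iff floor_eq int_iff
      using that sub disj' card_A wf(5,10) int by (elim disjE conjE) simp_all
    have p: "0 \<le> a / (a + b)" "a / (a + b) \<le> 1"
      using ab \<open>0 < a + b\<close> by auto
    \<comment> \<open>One of \<open>a\<close>, \<open>b\<close> may vanish here, but the comparison
      selects \<open>\<pi>\<^sub>1\<close> with probability \<open>a / (a + b)\<close>, so an empty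
      partial set is never selected on the support.\<close>
    have "(A\<^sub>1 \<union> A\<^sub>2, if le then \<pi>\<^sub>1 else \<pi>\<^sub>2, C\<^sub>1 + C\<^sub>2) \<in> latent_samples (U\<^sub>1 \<union> U\<^sub>2) (C\<^sub>1 + C\<^sub>2)"
      if "le \<in> set_pmf (uniform_le (a / (a + b)))" for le
    proof (cases le)
      case True
      then have "a \<noteq> 0"
        using True_in_uniform_le[OF p] that by auto
      with True new show ?thesis by simp
    next
      case False
      then have "b \<noteq> 0"
        using False_in_uniform_le[OF p] that \<open>0 < a + b\<close> by auto
      with False new show ?thesis by simp
    qed
    then show ?thesis
      unfolding L_eq latent_union.simps Let_def a_def[symmetric] b_def[symmetric] if_not_P[OF less(1)]
        if_P[OF less(2)] set_bind_pmf set_return_pmf by blast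
  next
    case eq
    \<comment> \<open>Each fractional part is below 1, so a sum equal to 1 forces both to be
      positive: both partial items exist and either may be promoted.\<close>
    then have "a \<noteq> 0" "b \<noteq> 0"
      using ab by auto
    have "(A\<^sub>1 \<union> A\<^sub>2 \<union> \<pi>, {}, C\<^sub>1 + C\<^sub>2) \<in> latent_samples (U\<^sub>1 \<union> U\<^sub>2) (C\<^sub>1 + C\<^sub>2)"
      if "\<pi> = \<pi>\<^sub>1 \<or> \<pi> = \<pi>\<^sub>2" for \<pi>
      unfolding latent_samples_iff floor_eq int_iff
      using that sub card_A\<pi>[of \<pi>] eq \<open>a \<noteq> 0\<close> \<open>b \<noteq> 0\<close> by (elim disjE) simp_all
    then have "(A\<^sub>1 \<union> A\<^sub>2 \<union> (if le then \<pi>\<^sub>1 else \<pi>\<^sub>2), {}, C\<^sub>1 + C\<^sub>2)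
        \<in> latent_samples (U\<^sub>1 \<union> U\<^sub>2) (C\<^sub>1 + C\<^sub>2)" for le
      by simp
    moreover have "\<not> a + b < 1"
      using eq by simp
    ultimately show ?thesis
      unfolding L_eq latent_union.simps Let_def a_def[symmetric] b_def[symmetric] if_not_P[OF eq(1)]
        if_not_P[OF \<open>\<not> a + b < 1\<close>] if_P[OF eq(2)] set_bind_pmf set_return_pmf by blast
  next
    case gr
    then have ab': "a \<noteq> 0" "b \<noteq> 0" and int: "a + b \<notin> \<int>" "\<lfloor>a + b\<rfloor> = 1"
      using ab by (auto elim!: Ints_cases simp: floor_eq_iff)
    have new: "(A\<^sub>1 \<union> A\<^sub>2 \<union> \<pi>, \<pi>', C\<^sub>1 + C\<^sub>2) \<in> latent_samples (U\<^sub>1 \<union> U\<^sub>2) (C\<^sub>1 + C\<^sub>2)"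
      if "\<pi> = \<pi>\<^sub>1 \<and> \<pi>' = \<pi>\<^sub>2 \<or> \<pi> = \<pi>\<^sub>2 \<and> \<pi>' = \<pi>\<^sub>1" for \<pi> \<pi>'
    proof -
      have "(A\<^sub>1 \<union> A\<^sub>2 \<union> \<pi>) \<inter> \<pi>' = {}"
        using that disj' disj(4) by auto
      then show ?thesis
        unfolding latent_samples_iff floor_eq int_iff
        using that sub card_A\<pi>[of \<pi>] wf(5,10) ab' int by (elim disjE conjE) simp_all
    qed
    show ?thesis
      unfolding L_eq latent_union.simps Let_def a_def[symmetric] b_def[symmetric] if_not_P[OF gr(1)]
        if_not_P[OF gr(2)] if_not_P[OF gr(3)] by (auto intro!: new)
  qed
qed

section \<open>Size of the realised sample\<close>

text \<open>The size depends on the latent sample only through its weight: the full items always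
  count, and the final comparison decides about the partial one.\<close>

lemma map_card_get_sample:
  assumes "finite U" "L \<in> latent_samples U C"
  shows "map_pmf card (get_sample L) =
    map_pmf (\<lambda>le. nat \<lfloor>C\<rfloor> + of_bool (le \<and> C \<notin> \<int>)) (uniform_le (frac C))"
proof -
  obtain A \<pi> where L_eq: "L = (A, \<pi>, C)"
    using assms by (auto simp: latent_samples_def)
  have "A \<subseteq> U" "\<pi> \<subseteq> U" "A \<inter> \<pi> = {}" "card A = nat \<lfloor>C\<rfloor>" "card \<pi> = of_bool (C \<notin> \<int>)"
    using assms by (auto simp: L_eq latent_samples_iff)
  moreover from this have "finite A" "finite \<pi>"
    using assms by (auto intro: finite_subset)
  ultimately show ?thesis
    unfolding L_eq get_sample.simps map_bind_pmf unfolding map_pmf_def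
    by (auto intro!: bind_pmf_cong simp: card_Un_disjoint bind_return_pmf)
qed

text \<open>The law of the size is the same for every latent sample in the support of
  \<open>P\<close>, so mixing over \<open>P\<close> leaves it unchanged. Its mean is
  \<open>\<lfloor>C\<rfloor> + frac C\<close>.\<close>

lemma expectation_card_get_sample:
  assumes U: "finite U" and P: "set_pmf P \<subseteq> latent_samples U C" and C: "0 \<le> C"
  shows "measure_pmf.expectation (P \<bind> get_sample) (\<lambda>S. real (card S)) = C"
proof -
  let ?Q = "map_pmf (\<lambda>le. nat \<lfloor>C\<rfloor> + of_bool (le \<and> C \<notin> \<int>)) (uniform_le (frac C))"
  have "map_pmf card (P \<bind> get_sample) = P \<bind> (\<lambda>L. map_pmf card (get_sample L))"
    by (rule map_bind_pmf)
  also have "\<dots> = P \<bind> (\<lambda>_. ?Q)"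
    using U P by (intro bind_pmf_cong refl map_card_get_sample) auto
  also have "\<dots> = ?Q"
    by simp
  finally have "measure_pmf.expectation (map_pmf card (P \<bind> get_sample)) real =
      measure_pmf.expectation ?Q real"
    by simp
  moreover have "frac C \<le> 1"
    using frac_lt_1[of C] by simp
  moreover have "real (nat \<lfloor>C\<rfloor>) = of_int \<lfloor>C\<rfloor>"
    using C by simp
  moreover have "frac C = C - of_int \<lfloor>C\<rfloor>"
    by (simp add: frac_def)
  ultimately show ?thesis
    by (cases "C \<in> \<int>") (auto simp: uniform_le_eq_bernoulli algebra_simps elim!: Ints_cases)
qed

section \<open>Deterministic evolution of total weight and shrinking factor\<close>

text \<open>Exponential decay turns sums of ages into products, so a single factor per step ages all
  earlier batches at once.\<close>

lemma rtbs_weight_eq_sum: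
  "rtbs_weight lam \<Delta> B k = (\<Sum>i=1..k. real (card (B i)) * decay lam (age \<Delta> i k))"
proof (induction k)
  case 0
  then show ?case by simp
next
  case (Suc k)
  have "exp (- lam * (arrival \<Delta> (Suc k) - arrival \<Delta> k)) * decay lam (age \<Delta> i k) =
      decay lam (age \<Delta> i (Suc k))" for i
    by (simp add: decay_def age_def exp_add[symmetric] algebra_simps)
  moreover have "decay lam (age \<Delta> (Suc k) (Suc k)) = 1"
    by (simp add: decay_def age_def)
  ultimately show ?case
    by (simp add: Suc sum_distrib_left mult.left_commute)
qed

lemma rtbs_weight_nonneg: "0 \<le> rtbs_weight lam \<Delta> B k"
  by (induction k) auto

lemma rtbs_rho_eq:
  "rtbs_rho lam \<Delta> n B k =
     (if rtbs_weight lam \<Delta> B k = 0 then 1 else min 1 (real n / rtbs_weight lam \<Delta> B k))"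
  by (cases k) (auto simp: Let_def)

lemma rtbs_rho_bounds:
  assumes "n \<ge> 1"
  shows "0 < rtbs_rho lam \<Delta> n B k" "rtbs_rho lam \<Delta> n B k \<le> 1"
  using assms rtbs_weight_nonneg[of lam \<Delta> B k] by (auto simp: rtbs_rho_eq)

text \<open>Provides the bound on the factor that \<open>downsample_support\<close> requires. If the
  old \<open>rtbs_rho\<close> is 1, both the new one and the decay factor are at most 1. Otherwise
  the old one is \<open>n / W\<close>, and the new weight is at least the decayed \<open>W\<close>
  since a batch only adds weight.\<close>

lemma rtbs_rho_decay_le:
  assumes "0 \<le> lam" "0 \<le> \<Delta>" "n \<ge> 1"
  shows "rtbs_rho lam \<Delta> n B (Suc k) / rtbs_rho lam \<Delta> n B k *
    exp (- lam * (arrival \<Delta> (Suc k) - arrival \<Delta> k)) \<le> 1"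
proof -
  define \<theta> where "\<theta> = exp (- lam * (arrival \<Delta> (Suc k) - arrival \<Delta> k))"
  define W W' where "W = rtbs_weight lam \<Delta> B k" and "W' = rtbs_weight lam \<Delta> B (Suc k)"
  define \<rho> \<rho>' where "\<rho> = rtbs_rho lam \<Delta> n B k" and "\<rho>' = rtbs_rho lam \<Delta> n B (Suc k)"
  have \<theta>: "0 < \<theta>" "\<theta> \<le> 1"
    using assms by (auto simp: \<theta>_def arrival_def algebra_simps)
  have W': "\<theta> * W \<le> W'" "0 \<le> W"
    using rtbs_weight_nonneg[of lam \<Delta> B k] by (auto simp: W'_def W_def \<theta>_def)
  have \<rho>: "0 < \<rho>" "\<rho>' \<le> 1"
    using rtbs_rho_bounds assms by (auto simp: \<rho>_def \<rho>'_def simp del: rtbs_rho.simps)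
  have "\<rho>' * \<theta> \<le> \<rho>"
  proof (cases "\<rho> = 1")
    case True
    then show ?thesis
      using \<rho> \<theta> mult_mono[of \<rho>' 1 \<theta> 1] by simp
  next
    case False
    then have "W > 0" and \<rho>_eq: "\<rho> = n / W"
      using W' by (auto simp: \<rho>_def rtbs_rho_eq W_def min_def split: if_splits)
    then have "\<theta> * W > 0"
      using \<theta> by simp
    then have "W' > 0"
      using W' by linarith
    then have "\<rho>' \<le> n / W'"
      by (simp del: rtbs_rho.simps rtbs_weight.simps add: \<rho>'_def rtbs_rho_eq W'_def[symmetric])
    also have "\<dots> \<le> n / (\<theta> * W)"
      using W' \<open>W' > 0\<close> \<open>\<theta> * W > 0\<close> by (intro divide_left_mono mult_pos_pos[of W' "\<theta> * W"]) auto
    finally show ?thesis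
      using \<theta> \<open>W > 0\<close> by (simp add: \<rho>_eq field_simps)
  qed
  then show ?thesis
    using \<rho> by (simp add: \<theta>_def \<rho>_def \<rho>'_def del: rtbs_rho.simps)
qed

section \<open>The invariant of R-TBS and its expected sample size\<close>

text \<open>Induction on time. Downsampling the old latent sample by
  \<open>\<rho> / \<rho>' * \<theta>\<close> cancels its factor \<open>\<rho>'\<close>, so old and
  new items carry the same factor \<open>\<rho>\<close> and their weights add up to
  \<open>\<rho>\<close> times the new total weight.\<close>

lemma rtbs_latent_support:
  assumes "0 \<le> lam" "0 \<le> \<Delta>" "n \<ge> 1"
    and fin: "\<And>i. i \<ge> 1 \<Longrightarrow> finite (B i)" and disj: "disjoint_family_on B {1..}"
  shows "set_pmf (rtbs_latent lam \<Delta> n B k) \<subseteq>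
    latent_samples (\<Union>i\<in>{1..k}. B i) (rtbs_rho lam \<Delta> n B k * rtbs_weight lam \<Delta> B k)"
proof (induction k)
  case 0
  then show ?case by (simp add: latent_samples_iff)
next
  case (Suc k)
  define \<theta> where "\<theta> = exp (- lam * (arrival \<Delta> (Suc k) - arrival \<Delta> k))"
  define W where "W = rtbs_weight lam \<Delta> B k"
  define \<rho> \<rho>' where "\<rho> = rtbs_rho lam \<Delta> n B (Suc k)" and "\<rho>' = rtbs_rho lam \<Delta> n B k"
  define U where "U = (\<Union>i\<in>{1..k}. B i)"
  define b where "b = real (card (B (Suc k)))"
  have W: "0 \<le> W" "rtbs_weight lam \<Delta> B (Suc k) = \<theta> * W + b"
    by (auto simp: W_def rtbs_weight_nonneg \<theta>_def b_def)
  have \<rho>: "0 < \<rho>" "\<rho> \<le> 1" "0 < \<rho>'"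
    using rtbs_rho_bounds \<open>n \<ge> 1\<close> by (auto simp: \<rho>_def \<rho>'_def simp del: rtbs_rho.simps)
  have \<theta>: "0 < \<theta>" "\<rho> / \<rho>' * \<theta> \<le> 1"
    using rtbs_rho_decay_le assms(1-3) by (auto simp: \<theta>_def \<rho>_def \<rho>'_def simp del: rtbs_rho.simps)
  have U: "finite U" "finite (B (Suc k))"
    using fin by (auto simp: U_def)
  have disj': "B (Suc k) \<inter> U = {}"
    using disjoint_family_onD[OF disj, of "Suc k"] by (force simp: U_def)
  have U_Suc: "(\<Union>i\<in>{1..Suc k}. B i) = B (Suc k) \<union> U"
    by (auto simp: U_def atLeastAtMostSuc_conv)
  \<comment> \<open>A whole batch is itself a well-formed latent sample: its weight is an integer
    and it has no partial item.\<close>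
  have new: "L\<^sub>0 \<in> latent_samples (B (Suc k)) (\<rho> * b)"
    if "L\<^sub>0 \<in> set_pmf (downsample (B (Suc k), {}, b) \<rho>)" for L\<^sub>0
    using downsample_support[of "B (Suc k)" b "(B (Suc k), {}, b)" \<rho>] that U \<rho>
    by (auto simp: latent_samples_iff b_def)
  have old: "L \<in> latent_samples U (\<rho> * (\<theta> * W))"
    if "(A, \<pi>, C) \<in> set_pmf (rtbs_latent lam \<Delta> n B k)"
      "L \<in> set_pmf (if C > 0 then downsample (A, \<pi>, C) ((\<rho> / \<rho>') * \<theta>) else return_pmf (A, \<pi>, C))"
    for A \<pi> C L
  proof -
    have L: "(A, \<pi>, C) \<in> latent_samples U (\<rho>' * W)"
      using Suc.IH that(1) by (auto simp: U_def \<rho>'_def W_def)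
    then have C: "C = \<rho>' * W"
      by (simp add: latent_samples_iff)
    show ?thesis
    proof (cases "C > 0")
      case True
      have "set_pmf (downsample (A, \<pi>, C) (\<rho> / \<rho>' * \<theta>)) \<subseteq>
          latent_samples U (\<rho> / \<rho>' * \<theta> * (\<rho>' * W))"
        using L U W \<rho> \<theta> by (intro downsample_support) auto
      moreover have "\<rho> / \<rho>' * \<theta> * (\<rho>' * W) = \<rho> * (\<theta> * W)"
        using \<rho> by simp
      ultimately show ?thesis
        using that(2) True by auto
    next
      case False
      \<comment> \<open>Skipping the downsampling is harmless: with \<open>\<rho>' > 0\<close> a
        vanishing weight \<open>\<rho>' * W\<close> gives \<open>W = 0\<close>, so the target weight
        is 0 too.\<close>
      then have "W = 0"
        using W \<rho> C by (simp add: not_less mult_le_0_iff)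
      then show ?thesis
        using that(2) False L by simp
    qed
  qed
  have union: "set_pmf (latent_union L\<^sub>0 L) \<subseteq> latent_samples (B (Suc k) \<union> U) (\<rho> * (\<theta> * W + b))"
    if "L\<^sub>0 \<in> latent_samples (B (Suc k)) (\<rho> * b)" "L \<in> latent_samples U (\<rho> * (\<theta> * W))" for L\<^sub>0 L
  proof -
    have "set_pmf (latent_union L\<^sub>0 L) \<subseteq> latent_samples (B (Suc k) \<union> U) (\<rho> * b + \<rho> * (\<theta> * W))"
      using that U disj' W \<rho> \<theta> by (intro latent_union_support) (auto simp: b_def)
    then show ?thesis
      by (simp add: algebra_simps)
  qed
  have "L' \<in> latent_samples (B (Suc k) \<union> U) (\<rho> * (\<theta> * W + b))"
    if L': "L' \<in> set_pmf (rtbs_latent lam \<Delta> n B (Suc k))" for L'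
  proof -
    obtain A \<pi> C L L\<^sub>0 where "(A, \<pi>, C) \<in> set_pmf (rtbs_latent lam \<Delta> n B k)"
      "L \<in> set_pmf (if C > 0 then downsample (A, \<pi>, C) ((\<rho> / \<rho>') * \<theta>) else return_pmf (A, \<pi>, C))"
      "L\<^sub>0 \<in> set_pmf (downsample (B (Suc k), {}, b) \<rho>)" "L' \<in> set_pmf (latent_union L\<^sub>0 L)"
      using L' unfolding rtbs_latent.simps Let_def \<theta>_def[symmetric] \<rho>_def[symmetric]
        \<rho>'_def[symmetric] b_def[symmetric] by (force simp del: downsample.simps)
    then show ?thesis
      using union[OF new old] by blast
  qed
  then show ?case
    unfolding U_Suc W(2) \<rho>_def[symmetric] by blast
qed

lemma expectation_card_rtbs_sample:
  assumes "0 \<le> lam" "0 \<le> \<Delta>" "n \<ge> 1"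
    and "\<And>i. i \<ge> 1 \<Longrightarrow> finite (B i)" and "disjoint_family_on B {1..}"
  shows "measure_pmf.expectation (rtbs_sample lam \<Delta> n B k) (\<lambda>S. real (card S)) =
    rtbs_rho lam \<Delta> n B k * rtbs_weight lam \<Delta> B k"
  unfolding rtbs_sample_def
  using rtbs_rho_bounds(1)[OF \<open>n \<ge> 1\<close>, of lam \<Delta> B k] assms
  by (intro expectation_card_get_sample[OF _ rtbs_latent_support])
    (auto simp: rtbs_weight_nonneg)

section \<open>Inclusion probabilities and the comparison\<close>

text \<open>Linearity of expectation, applied to the size as a sum of membership indicators.
  Measurability into \<open>count_space (Pow U)\<close> makes membership events measurable and keeps
  the values inside \<open>U\<close>.\<close>

lemma (in prob_space) expectation_card_random_subset:
  assumes "finite U" "S \<in> measurable M (count_space (Pow U))"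
  shows "expectation (\<lambda>\<omega>. real (card (S \<omega>))) = (\<Sum>x\<in>U. prob {\<omega> \<in> space M. x \<in> S \<omega>})"
proof -
  have sets: "{\<omega> \<in> space M. x \<in> S \<omega>} \<in> sets M" for x
  proof -
    have "S -` {T \<in> Pow U. x \<in> T} \<inter> space M \<in> sets M"
      using assms(2) by (rule measurable_sets) auto
    also have "S -` {T \<in> Pow U. x \<in> T} \<inter> space M = {\<omega> \<in> space M. x \<in> S \<omega>}"
      using measurable_space[OF assms(2)] by auto
    finally show ?thesis .
  qed
  have "real (card (S \<omega>)) = (\<Sum>x\<in>U. indicator {\<omega> \<in> space M. x \<in> S \<omega>} \<omega>)" if "\<omega> \<in> space M" for \<omega>
  proof -
    have "S \<omega> \<subseteq> U"
      using measurable_space[OF assms(2) that] by simp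
    then have "U \<inter> {x. x \<in> S \<omega>} = S \<omega>"
      by auto
    then show ?thesis
      using assms(1) that by (simp add: indicator_def)
  qed
  then have "expectation (\<lambda>\<omega>. real (card (S \<omega>))) =
      expectation (\<lambda>\<omega>. \<Sum>x\<in>U. indicator {\<omega> \<in> space M. x \<in> S \<omega>} \<omega>)"
    by (intro Bochner_Integration.integral_cong) auto
  also have "\<dots> = (\<Sum>x\<in>U. prob {\<omega> \<in> space M. x \<in> S \<omega>})"
    using sets by (subst Bochner_Integration.integral_sum) (auto simp: emeasure_eq_measure)
  finally show ?thesis .
qed

theorem theorem4p4:
  fixes lam \<Delta> :: real and n k :: nat
    and B :: "nat \<Rightarrow> 'a set"
    and M :: "'w measure" and SH :: "nat \<Rightarrow> 'w \<Rightarrow> 'a set"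
  assumes "lam \<ge> 0" and "\<Delta> > 0" and "n \<ge> 1"
    and "\<And>i. i \<ge> 1 \<Longrightarrow> finite (B i)"
    and "disjoint_family_on B {1..}"
    and "prob_space M"
    and "\<And>j. j \<ge> 1 \<Longrightarrow> SH j \<in> measurable M (count_space (Pow (\<Union>i\<in>{1..j}. B i)))"
    and "\<And>i j l x y. 1 \<le> i \<Longrightarrow> i \<le> j \<Longrightarrow> j \<le> l \<Longrightarrow> x \<in> B i \<Longrightarrow> y \<in> B j \<Longrightarrow>
           measure M {\<omega> \<in> space M. x \<in> SH l \<omega>} / measure M {\<omega> \<in> space M. y \<in> SH l \<omega>}
             = decay lam (age \<Delta> i l) / decay lam (age \<Delta> j l)"
    and "k \<ge> 1"
    and "(\<Sum>i=1..k. real (card (B i)) * decay lam (age \<Delta> i k)) < real n"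
    and "lam > 0 \<Longrightarrow> (\<Union>i\<in>{1..k}. B i) \<noteq> {} \<Longrightarrow> B k \<noteq> {}"
  shows "prob_space.expectation M (\<lambda>\<omega>. real (card (SH k \<omega>)))
           \<le> measure_pmf.expectation (rtbs_sample lam \<Delta> n B k) (\<lambda>S. real (card S))"
proof -
  interpret prob_space M by fact
  define p where "p x = prob {\<omega> \<in> space M. x \<in> SH k \<omega>}" for x
  \<comment> \<open>For \<open>lam = 0\<close> the bound is just that a probability is at most 1.
    Otherwise \<open>x\<close> shows that some item has arrived, so the current batch contains some
    \<open>y\<close>, whose decay value is 1.\<close>
  have p_le: "p x \<le> decay lam (age \<Delta> i k)" if i: "1 \<le> i" "i \<le> k" "x \<in> B i" for i x
  proof (cases "lam = 0")
    case True
    then show ?thesis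
      by (simp add: p_def decay_def)
  next
    case False
    then obtain y where "y \<in> B k"
      using assms(1,11) i by fastforce
    moreover have "decay lam (age \<Delta> k k) = 1"
      by (simp add: decay_def age_def)
    ultimately have ratio: "p x / p y = decay lam (age \<Delta> i k)"
      using assms(8)[of i k k x y] i by (simp add: p_def)
    have "0 < decay lam (age \<Delta> i k)"
      by (simp add: decay_def)
    \<comment> \<open>Since \<open>p x / 0 = 0\<close>, the ratio law forces \<open>p y\<close> to be nonzero.\<close>
    with ratio have "p y \<noteq> 0"
      by auto
    then have "p x = decay lam (age \<Delta> i k) * p y"
      using ratio by (simp add: field_simps)
    also have "\<dots> \<le> decay lam (age \<Delta> i k)"
      using \<open>0 < decay lam (age \<Delta> i k)\<close> by (simp add: p_def mult_left_le)
    finally show ?thesis .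
  qed
  have "expectation (\<lambda>\<omega>. real (card (SH k \<omega>))) = (\<Sum>x\<in>(\<Union>i\<in>{1..k}. B i). p x)"
    unfolding p_def using assms(4,7,9) by (intro expectation_card_random_subset) auto
  also have "\<dots> = (\<Sum>i=1..k. \<Sum>x\<in>B i. p x)"
    using assms(4,5) by (intro sum.UNION_disjoint) (auto simp: disjoint_family_on_def)
  \<comment> \<open>The only inequality in the chain; every other link is an equality.\<close>
  also have "\<dots> \<le> (\<Sum>i=1..k. \<Sum>x\<in>B i. decay lam (age \<Delta> i k))"
    using p_le by (intro sum_mono) auto
  also have "\<dots> = rtbs_weight lam \<Delta> B k"
    by (simp add: rtbs_weight_eq_sum)
  \<comment> \<open>The bound \<open>W < n\<close> enters here: it makes \<open>rtbs_rho\<close>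
    equal to 1, through \<open>n / W > 1\<close> if \<open>W > 0\<close> and through the convention
    for \<open>n / 0\<close> if \<open>W = 0\<close>.\<close>
  also have "\<dots> = rtbs_rho lam \<Delta> n B k * rtbs_weight lam \<Delta> B k"
    using assms(10)[folded rtbs_weight_eq_sum[of lam \<Delta> B k]] rtbs_weight_nonneg[of lam \<Delta> B k]
    by (auto simp: rtbs_rho_eq min_def divide_simps)
  also have "\<dots> = measure_pmf.expectation (rtbs_sample lam \<Delta> n B k) (\<lambda>S. real (card S))"
    using assms(1-5) by (intro expectation_card_rtbs_sample[symmetric]) auto
  finally show ?thesis .
qed

end
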